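(* Let $n\ge 2$ and let $A_1,\dots,A_n$ be groups. There is a bijective correspondence $G\mapsto Q_n(G)$ between the subgroups $G\le A_1\times\cdots\times A_n$ and the $(3n-2)$-tuples $$Q=\{H_1,\;H_2,\,K_2,\,\theta_1,\;H_3,\,K_3,\,\theta_2,\;\ldots,\;H_n,\,K_n,\,\theta_{n-1}\}$$ such that $H_i\le A_i$ for $1\le i\le n$, $K_i\unlhd H_i$ for $2\le i\le n$, and, for $1\le i\le n-1$, $\theta_i:\Lambda_i\twoheadrightarrow H_{i+1}/K_{i+1}$ is a surjective group homomorphism, where the subgroups $\Lambda_i\le A_1\times\cdots\times A_i$ are defined recursively by $\Lambda_1:=H_1$ and $$\Lambda_{i+1}:=\Gamma_2(\{\Lambda_i,\,H_{i+1},\,K_{i+1},\,\theta_i\})\le (A_1\times\cdots\times A_i)\times A_{i+1}.$$ Under this correspondence a subgroup $G$ corresponds to $$Q_n(G)=\{\overline{G}_1,\;\overline{G}_2,\,G(2|1),\,\theta_1,\;\ldots,\;\overline{G}_n,\,G(n|1,\ldots,n-1),\,\theta_{n-1}\},$$ i.e. $H_i=\overline{G}_i$ for $1\le i\le n$ and $K_i=G(i|1,\ldots,i-1)$ for $2\le i\le n$.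
   Context: The neutral element of every group is written $e$. Tuples are ordered. For a subgroup $G\le A_1\times\cdots\times A_n$, a subset $S\subset\{1,\dots,n\}$ and $j\in\{1,\dots,n\}\setminus S$, put $$G(j|S):=\{x_j\in A_j \mid (x_1,\dots,x_j,\dots,x_n)\in G \text{ for some } x_i\in A_i\ (i\ne j) \text{ with } x_i=e \text{ if } i\in S\}.$$ Set braces are omitted, e.g. $G(3|1,2)=G(3|\{1,2\})$. Also $\overline{G}_j:=G(j|\emptyset)=\pi_j(G)$, the projection of $G$ to $A_j$. The operation $\Gamma_2$: given groups $A,B$ and a quadruple $\{H,L,K,\theta\}$ with $H\le A$, $K\unlhd L\le B$ and $\theta:H\twoheadrightarrow L/K$ a surjective homomorphism, $\Gamma_2(\{H,L,K,\theta\})$ is the subgroup $p^{-1}(\mathcal{G}_\theta)$ of $A\times B$, where $\mathcal{G}_\theta\subseteq H\times (L/K)$ is the graph of $\theta$ and $p:H\times L\to H\times (L/K)$ is the natural surjection; that is, $\Gamma_2(\{H,L,K,\theta\})=\{(a,b)\in H\times L \mid \theta(a)=bK\}$. The homomorphisms $\theta_i$ in $Q_n(G)$: for $H_j=\overline{G}_j$, $K_j=G(j|1,\dots,j-1)$, the group $\Lambda_i$ is the projection of $G$ to $A_1\times\cdots\times A_i$, and $\theta_i(a_1,\dots,a_i)$ is the class $[a_{i+1}]\in\overline{G}_{i+1}/G(i+1|1,\dots,i)$ for any $a_{i+1},\dots,a_n$ with $(a_1,\dots,a_n)\in G$. *)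

theory Defs
  imports "HOL-Algebra.Algebra"
begin

text \<open>
  The direct product \<open>A\<^sub>1 \<times> \<dots> \<times> A\<^sub>i\<close> is \<open>product_group {1..i} A\<close>, whose elements are the functions
  in \<open>\<Pi>\<^sub>E j\<in>{1..i}. carrier (A j)\<close>.  In particular \<open>A\<^sub>1\<close> is identified with the product over
  \<open>{1}\<close>, and \<open>(A\<^sub>1 \<times> \<dots> \<times> A\<^sub>i) \<times> A\<^sub>i\<^sub>+\<^sub>1\<close> with the product over \<open>{1..i+1}\<close>, through
  \<open>(a, b) \<mapsto> a(i+1 := b)\<close>.
\<close>

text \<open>\<open>G(j|S)\<close>; the case \<open>S = {}\<close> is the projection of \<open>G\<close> to \<open>A\<^sub>j\<close>.\<close>

definition section_at ::
  "(nat \<Rightarrow> ('a, 'm) monoid_scheme) \<Rightarrow> (nat \<Rightarrow> 'a) set \<Rightarrow> nat \<Rightarrow> nat set \<Rightarrow> 'a set" where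
  "section_at A G j S = {x j | x. x \<in> G \<and> (\<forall>i\<in>S. x i = \<one>\<^bsub>A i\<^esub>)}"

definition initial_proj :: "(nat \<Rightarrow> 'a) set \<Rightarrow> nat \<Rightarrow> (nat \<Rightarrow> 'a) set" where
  "initial_proj G i = (\<lambda>x. restrict x {1..i}) ` G"

text \<open>
  \<open>\<Gamma>\<^sub>2\<close> as a subset of a product with second factor \<open>B\<close>.  Quotients in HOL-Algebra consist of right
  cosets; for normal \<open>K\<close> these agree with the left cosets \<open>bK\<close>.
\<close>

definition Gamma2 ::
  "('b, 'm) monoid_scheme \<Rightarrow> 'a set \<Rightarrow> 'b set \<Rightarrow> 'b set \<Rightarrow> ('a \<Rightarrow> 'b set) \<Rightarrow> ('a \<times> 'b) set" where
  "Gamma2 B H L K \<theta> = {(a, b). a \<in> H \<and> b \<in> L \<and> \<theta> a = K #>\<^bsub>B\<^esub> b}"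

text \<open>\<open>\<Lambda>\<^sub>i\<close> for \<open>i \<ge> 1\<close>; the value at \<open>0\<close> (the empty product) is never used.\<close>

fun Lambda_rec ::
  "(nat \<Rightarrow> ('a, 'm) monoid_scheme) \<Rightarrow> (nat \<Rightarrow> 'a set) \<Rightarrow> (nat \<Rightarrow> 'a set) \<Rightarrow>
   (nat \<Rightarrow> (nat \<Rightarrow> 'a) \<Rightarrow> 'a set) \<Rightarrow> nat \<Rightarrow> (nat \<Rightarrow> 'a) set" where
  "Lambda_rec A H K \<theta> 0 = {\<lambda>_. undefined}"
| "Lambda_rec A H K \<theta> (Suc 0) = (\<Pi>\<^sub>E j\<in>{1}. H j)"
| "Lambda_rec A H K \<theta> (Suc (Suc i)) =
     (\<lambda>(a, b). a(Suc (Suc i) := b)) `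
       Gamma2 (A (Suc (Suc i))) (Lambda_rec A H K \<theta> (Suc i))
         (H (Suc (Suc i))) (K (Suc (Suc i))) (\<theta> (Suc i))"

text \<open>
  A \<open>(3n-2)\<close>-tuple is encoded by three families \<open>H\<close>, \<open>K\<close>, \<open>\<theta>\<close> indexed by \<open>{1..n}\<close>, \<open>{2..n}\<close> and
  \<open>{1..n-1}\<close>.  The \<open>extensional\<close> conditions make equality of the encodings coincide with
  equality of the tuples.
\<close>

type_synonym 'a goursat_tuple =
  "(nat \<Rightarrow> 'a set) \<times> (nat \<Rightarrow> 'a set) \<times> (nat \<Rightarrow> (nat \<Rightarrow> 'a) \<Rightarrow> 'a set)"

definition goursat_tuples ::
  "(nat \<Rightarrow> ('a, 'm) monoid_scheme) \<Rightarrow> nat \<Rightarrow> 'a goursat_tuple set" where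
  "goursat_tuples A n = {(H, K, \<theta>).
     H \<in> extensional {1..n} \<and> K \<in> extensional {2..n} \<and> \<theta> \<in> extensional {1..n-1} \<and>
     (\<forall>i\<in>{1..n}. subgroup (H i) (A i)) \<and>
     (\<forall>i\<in>{2..n}. K i \<lhd> (A i)\<lparr>carrier := H i\<rparr>) \<and>
     (\<forall>i\<in>{1..n-1}.
        \<theta> i \<in> extensional (Lambda_rec A H K \<theta> i) \<and>
        \<theta> i \<in> epi ((product_group {1..i} A)\<lparr>carrier := Lambda_rec A H K \<theta> i\<rparr>)
                 ((A (i+1))\<lparr>carrier := H (i+1)\<rparr> Mod K (i+1)))}"

definition goursat_theta ::
  "(nat \<Rightarrow> ('a, 'm) monoid_scheme) \<Rightarrow> (nat \<Rightarrow> 'a) set \<Rightarrow> nat \<Rightarrow> (nat \<Rightarrow> 'a) \<Rightarrow> 'a set" where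
  "goursat_theta A G i = (\<lambda>a\<in>initial_proj G i.
     THE C. \<forall>x\<in>G. restrict x {1..i} = a \<longrightarrow>
       C = section_at A G (i+1) {1..i} #>\<^bsub>A (i+1)\<^esub> x (i+1))"

definition Q ::
  "(nat \<Rightarrow> ('a, 'm) monoid_scheme) \<Rightarrow> nat \<Rightarrow> (nat \<Rightarrow> 'a) set \<Rightarrow> 'a goursat_tuple" where
  "Q A n G =
     ((\<lambda>i\<in>{1..n}. section_at A G i {}),
      (\<lambda>i\<in>{2..n}. section_at A G i {1..i-1}),
      (\<lambda>i\<in>{1..n-1}. goursat_theta A G i))"

end

theory Submission
  imports Defs
begin

text \<open>
  The inverse of \<open>G \<mapsto> Q\<^sub>n(G)\<close> sends a tuple to \<open>\<Lambda>\<^sub>n\<close>.  For \<open>x, y \<in> G\<close> with the same first \<open>i\<close>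
  coordinates, \<open>y x\<^sup>-\<^sup>1\<close> has trivial first \<open>i\<close> coordinates, so \<open>x\<^sub>i\<^sub>+\<^sub>1\<close> and \<open>y\<^sub>i\<^sub>+\<^sub>1\<close> lie in the same coset
  of \<open>G(i+1|1,\<dots>,i)\<close>; this makes \<open>\<theta>\<^sub>i\<close> well defined.  Conversely, multiplying \<open>x\<close> by elements of \<open>G\<close>
  with trivial first \<open>i\<close> coordinates reaches the whole coset, whence by induction \<open>\<Lambda>\<^sub>i\<close> is the
  projection of \<open>G\<close>, and \<open>\<Lambda>\<^sub>n = G\<close>.  Starting from a tuple, surjectivity of the \<open>\<theta>\<^sub>i\<close> shows that
  \<open>\<Lambda>\<^sub>n\<close> projects onto \<open>\<Lambda>\<^sub>i\<close> and onto \<open>H\<^sub>i\<close>, and \<open>K\<^sub>i\<close> is recovered as the set of \<open>b\<close> for which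
  the trivial coset equals \<open>K\<^sub>i b\<close>.
\<close>

section \<open>Truncation to initial coordinates, and sections\<close>

lemma restrict_restrict_initial:
  fixes i j :: nat
  assumes "i \<le> j"
  shows "restrict (restrict x {1..j}) {1..i} = restrict x {1..i}"
  using assms by auto

lemma initial_proj_initial_proj:
  assumes "i \<le> j"
  shows "initial_proj (initial_proj G j) i = initial_proj G i"
  unfolding initial_proj_def image_image restrict_restrict_initial[OF assms] ..

lemma initial_proj_self:
  assumes "G \<subseteq> extensional {1..i}"
  shows "initial_proj G i = G"
  using assms by (force simp: initial_proj_def extensional_restrict)

text \<open>Only coordinate \<open>j\<close> and those in \<open>S\<close> are inspected, so
  coordinates beyond \<open>m\<close> can be cut off. Sections of \<open>\<Lambda>\<^sub>n\<close>
  can therefore be computed in \<open>\<Lambda>\<^sub>i\<close>.\<close>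

lemma section_at_initial_proj:
  fixes G :: "(nat \<Rightarrow> 'a) set"
  assumes "j \<in> {1..m}" "S \<subseteq> {1..m}"
  shows "section_at A (initial_proj G m) j S = section_at A G j S"
proof -
  have "restrict x {1..m} j = x j" "(\<forall>i\<in>S. restrict x {1..m} i = \<one>\<^bsub>A i\<^esub>) \<longleftrightarrow> (\<forall>i\<in>S. x i = \<one>\<^bsub>A i\<^esub>)"
    for x :: "nat \<Rightarrow> 'a"
    using assms by (auto simp: subset_iff)
  moreover have "section_at A (initial_proj G m) j S =
      {restrict x {1..m} j | x. x \<in> G \<and> (\<forall>i\<in>S. restrict x {1..m} i = \<one>\<^bsub>A i\<^esub>)}"
    unfolding section_at_def initial_proj_def by blast
  ultimately show ?thesis by (simp only: section_at_def)
qed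

lemma goursat_theta_extensional: "goursat_theta A G i \<in> extensional (initial_proj G i)"
  by (simp add: goursat_theta_def)

lemma section_atI:
  assumes "x \<in> G" "\<And>i. i \<in> S \<Longrightarrow> x i = \<one>\<^bsub>A i\<^esub>" "x j = a"
  shows "a \<in> section_at A G j S"
  using assms by (auto simp: section_at_def)

section \<open>Subgroups of a product in coordinates\<close>

lemma subgroup_productD:
  assumes G: "subgroup G (product_group I A)" and A: "\<forall>i\<in>I. group (A i)"
  shows "x \<in> G \<Longrightarrow> x \<in> (\<Pi>\<^sub>E i\<in>I. carrier (A i))"
    and "x \<in> G \<Longrightarrow> y \<in> G \<Longrightarrow> (\<lambda>i\<in>I. x i \<otimes>\<^bsub>A i\<^esub> y i) \<in> G"
    and "x \<in> G \<Longrightarrow> (\<lambda>i\<in>I. inv\<^bsub>A i\<^esub> x i) \<in> G"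
    and "(\<lambda>i\<in>I. \<one>\<^bsub>A i\<^esub>) \<in> G"
proof -
  show *: "x \<in> (\<Pi>\<^sub>E i\<in>I. carrier (A i))" if "x \<in> G" for x
    using subgroup.subset[OF G] that by auto
  show "(\<lambda>i\<in>I. x i \<otimes>\<^bsub>A i\<^esub> y i) \<in> G" if "x \<in> G" "y \<in> G"
    using subgroup.m_closed[OF G that] by simp
  show "(\<lambda>i\<in>I. inv\<^bsub>A i\<^esub> x i) \<in> G" if "x \<in> G"
    using subgroup.m_inv_closed[OF G that] inv_product_group[OF *[OF that]] A by simp
  show "(\<lambda>i\<in>I. \<one>\<^bsub>A i\<^esub>) \<in> G"
    using subgroup.one_closed[OF G] by simp
qed

lemma subgroup_productI:
  assumes A: "\<forall>i\<in>I. group (A i)"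
    and sub: "G \<subseteq> (\<Pi>\<^sub>E i\<in>I. carrier (A i))"
    and one: "(\<lambda>i\<in>I. \<one>\<^bsub>A i\<^esub>) \<in> G"
    and mult: "\<And>x y. x \<in> G \<Longrightarrow> y \<in> G \<Longrightarrow> (\<lambda>i\<in>I. x i \<otimes>\<^bsub>A i\<^esub> y i) \<in> G"
    and inv: "\<And>x. x \<in> G \<Longrightarrow> (\<lambda>i\<in>I. inv\<^bsub>A i\<^esub> x i) \<in> G"
  shows "subgroup G (product_group I A)"
proof -
  interpret group "product_group I A" using A by simp
  show ?thesis
  proof (rule subgroupI)
    show "inv\<^bsub>product_group I A\<^esub> x \<in> G" if "x \<in> G" for x
      using inv[OF that] inv_product_group[of x I A] A sub that by auto
  qed (use sub one mult in auto)
qed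

section \<open>Membership in \<open>\<Lambda>\<^sub>i\<close>\<close>

lemma Lambda_rec_extensional:
  "Lambda_rec A H K \<theta> (Suc i) \<subseteq> extensional {1..Suc i}"
  by (induction i) (force simp: Gamma2_def PiE_def extensional_def)+

lemma Lambda_rec_1_iff:
  "x \<in> Lambda_rec A H K \<theta> (Suc 0) \<longleftrightarrow> x \<in> extensional {1..Suc 0} \<and> x (Suc 0) \<in> H (Suc 0)"
  by (auto simp: PiE_iff)

text \<open>Stated with \<open>(restrict x {1..i}, x (i+1))\<close>, the inverse of \<open>(a, b) \<mapsto> a(i+1 := b)\<close>, so that
  products and inverses in \<open>\<Lambda>\<^sub>i\<^sub>+\<^sub>1\<close> need no choice of preimages.\<close>

lemma Lambda_rec_Suc_iff:
  assumes "i \<ge> 1"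
  shows "x \<in> Lambda_rec A H K \<theta> (Suc i) \<longleftrightarrow>
    x \<in> extensional {1..Suc i} \<and> restrict x {1..i} \<in> Lambda_rec A H K \<theta> i \<and>
    x (Suc i) \<in> H (Suc i) \<and> \<theta> i (restrict x {1..i}) = K (Suc i) #>\<^bsub>A (Suc i)\<^esub> x (Suc i)"
    (is "?l \<longleftrightarrow> ?r")
proof -
  \<comment> \<open>The recursion equation with \<open>Gamma2\<close> matches only
    \<open>Suc (Suc k)\<close>, so \<open>i\<close> has to be exposed as a successor.\<close>
  obtain k where k: "i = Suc k" using assms by (cases i) auto
  note ext = Lambda_rec_extensional[of A H K \<theta> k]
  show ?thesis
  proof
    assume ?l
    then obtain a b where ab: "x = a(Suc i := b)" "a \<in> Lambda_rec A H K \<theta> i"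
      "b \<in> H (Suc i)" "\<theta> i a = K (Suc i) #>\<^bsub>A (Suc i)\<^esub> b"
      by (auto simp: k Gamma2_def)
    have "restrict x {1..i} = restrict a {1..i}"
      by (auto simp: ab)
    also have "\<dots> = a"
      using ext ab(2) by (intro extensional_restrict) (auto simp: k)
    finally show ?r
      using ab Lambda_rec_extensional[of A H K \<theta> i] \<open>?l\<close> by auto
  next
    assume r: ?r
    then have "x = (restrict x {1..i})(Suc i := x (Suc i))"
      by (auto simp: extensional_def fun_eq_iff)
    with r show ?l
      by (auto simp: k Gamma2_def image_iff intro!: exI[of _ "restrict x {1..i}"] exI[of _ "x (Suc i)"])
  qed
qed

section \<open>Sections of a subgroup and their cosets\<close>

context
  fixes A :: "nat \<Rightarrow> ('a, 'm) monoid_scheme" and I :: "nat set" and G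
  assumes A: "\<forall>i\<in>I. group (A i)" and G: "subgroup G (product_group I A)"
begin

text \<open>The elements of \<open>G\<close> that are trivial on \<open>S\<close> form a subgroup,
  and the section is its image under projection to \<open>A j\<close>. Closure is checked on such
  lifts.\<close>

lemma section_at_subgroup:
  assumes "j \<in> I" "S \<subseteq> I"
  shows "subgroup (section_at A G j S) (A j)"
proof -
  interpret group "A j" using A assms by simp
  note D = subgroup_productD[OF G A]
  \<comment> \<open>The factors are different groups, so triviality of products and inverses on
    \<open>S\<close> is derived index by index.\<close>
  have one: "\<one>\<^bsub>A i\<^esub> \<otimes>\<^bsub>A i\<^esub> \<one>\<^bsub>A i\<^esub> = \<one>\<^bsub>A i\<^esub>" "inv\<^bsub>A i\<^esub> \<one>\<^bsub>A i\<^esub> = \<one>\<^bsub>A i\<^esub>" if "i \<in> S" for i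
  proof -
    interpret B: group "A i" using A that assms by auto
    show "\<one>\<^bsub>A i\<^esub> \<otimes>\<^bsub>A i\<^esub> \<one>\<^bsub>A i\<^esub> = \<one>\<^bsub>A i\<^esub>" "inv\<^bsub>A i\<^esub> \<one>\<^bsub>A i\<^esub> = \<one>\<^bsub>A i\<^esub>" by simp_all
  qed
  show ?thesis
  proof (rule subgroupI)
    show "section_at A G j S \<subseteq> carrier (A j)"
      using D(1) assms by (auto simp: section_at_def)
    show "section_at A G j S \<noteq> {}"
      using D(4) assms by (force simp: section_at_def)
  next
    fix a assume "a \<in> section_at A G j S"
    then obtain x where "x \<in> G" "\<forall>i\<in>S. x i = \<one>\<^bsub>A i\<^esub>" "a = x j"
      by (auto simp: section_at_def)
    then show "inv\<^bsub>A j\<^esub> a \<in> section_at A G j S"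
      using D(3)[of x] assms one
      by (auto simp: section_at_def subset_iff intro!: exI[of _ "\<lambda>i\<in>I. inv\<^bsub>A i\<^esub> x i"])
  next
    fix a b assume "a \<in> section_at A G j S" "b \<in> section_at A G j S"
    then obtain x y where "x \<in> G" "\<forall>i\<in>S. x i = \<one>\<^bsub>A i\<^esub>" "a = x j"
      "y \<in> G" "\<forall>i\<in>S. y i = \<one>\<^bsub>A i\<^esub>" "b = y j"
      by (auto simp: section_at_def)
    then show "a \<otimes>\<^bsub>A j\<^esub> b \<in> section_at A G j S"
      using D(2)[of x y] assms one
      by (auto simp: section_at_def subset_iff intro!: exI[of _ "\<lambda>i\<in>I. x i \<otimes>\<^bsub>A i\<^esub> y i"])
  qed
qed

text \<open>A lift that is trivial on \<open>S\<close> stays trivial on \<open>S\<close> when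
  conjugated by any element of \<open>G\<close>, and every element of
  \<open>section_at A G j {}\<close> has a lift in \<open>G\<close> to conjugate with.\<close>

lemma section_at_normal:
  assumes "j \<in> I" "S \<subseteq> I"
  shows "section_at A G j S \<lhd> (A j)\<lparr>carrier := section_at A G j {}\<rparr>"
proof -
  interpret A: group "A j" using A assms by simp
  have H: "subgroup (section_at A G j {}) (A j)"
    using section_at_subgroup assms by simp
  interpret H: group "(A j)\<lparr>carrier := section_at A G j {}\<rparr>"
    using subgroup.subgroup_is_group[OF H] A assms by simp
  note D = subgroup_productD[OF G A]
  show ?thesis
    unfolding H.normal_inv_iff
  proof (intro conjI ballI)
    have "section_at A G j S \<subseteq> section_at A G j {}"
      by (auto simp: section_at_def)
    then show "subgroup (section_at A G j S) ((A j)\<lparr>carrier := section_at A G j {}\<rparr>)"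
      using A.subgroup_incl H section_at_subgroup assms by blast
  next
    fix a b
    assume "a \<in> carrier ((A j)\<lparr>carrier := section_at A G j {}\<rparr>)" and "b \<in> section_at A G j S"
    then have a: "a \<in> section_at A G j {}" and b: "b \<in> section_at A G j S" by auto
    obtain x y where xy: "x \<in> G" "a = x j" "y \<in> G" "\<forall>i\<in>S. y i = \<one>\<^bsub>A i\<^esub>" "b = y j"
      using a b by (auto simp: section_at_def)
    \<comment> \<open>\<open>z\<close> is the conjugate \<open>x y x^-1\<close> in the product; the
      inner restrictions are kept so that the closure rules \<open>D\<close> apply
      literally.\<close>
    define z where "z = (\<lambda>i\<in>I. (\<lambda>i\<in>I. x i \<otimes>\<^bsub>A i\<^esub> y i) i \<otimes>\<^bsub>A i\<^esub> (\<lambda>i\<in>I. inv\<^bsub>A i\<^esub> x i) i)"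
    have "z \<in> G" unfolding z_def using xy by (intro D)
    moreover have "z i = \<one>\<^bsub>A i\<^esub>" if "i \<in> S" for i
    proof -
      have i: "i \<in> I" using that assms by auto
      interpret B: group "A i" using A i by blast
      show ?thesis using D(1)[OF xy(1)] that i xy(4) by (auto simp: z_def PiE_iff)
    qed
    moreover have "z j = a \<otimes>\<^bsub>A j\<^esub> b \<otimes>\<^bsub>A j\<^esub> inv\<^bsub>A j\<^esub> a"
      using assms xy by (simp add: z_def)
    ultimately have "a \<otimes>\<^bsub>A j\<^esub> b \<otimes>\<^bsub>A j\<^esub> inv\<^bsub>A j\<^esub> a \<in> section_at A G j S"
      by (intro section_atI[of z]) auto
    then show "a \<otimes>\<^bsub>(A j)\<lparr>carrier := section_at A G j {}\<rparr>\<^esub> b \<otimes>\<^bsub>(A j)\<lparr>carrier := section_at A G j {}\<rparr>\<^esub>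
        inv\<^bsub>(A j)\<lparr>carrier := section_at A G j {}\<rparr>\<^esub> a \<in> section_at A G j S"
      using A.m_inv_consistent[OF H a] by simp
  qed
qed

text \<open>Serves to make \<open>goursat_theta\<close> independent of the chosen lift: the quotient
  of two elements of \<open>G\<close> that agree on \<open>S\<close> is trivial on
  \<open>S\<close>.\<close>

lemma section_at_coset_eq:
  assumes "j \<in> I" "S \<subseteq> I" and x: "x \<in> G" and y: "y \<in> G" and eq: "\<And>i. i \<in> S \<Longrightarrow> x i = y i"
  shows "section_at A G j S #>\<^bsub>A j\<^esub> x j = section_at A G j S #>\<^bsub>A j\<^esub> y j"
proof -
  interpret A: group "A j" using A assms by simp
  note D = subgroup_productD[OF G A]
  \<comment> \<open>\<open>z\<close> is \<open>y x^-1\<close> in the product, so its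
    \<open>j\<close>-th coordinate is the element that relates the two cosets.\<close>
  define z where "z = (\<lambda>i\<in>I. y i \<otimes>\<^bsub>A i\<^esub> (\<lambda>i\<in>I. inv\<^bsub>A i\<^esub> x i) i)"
  have "z \<in> G" unfolding z_def using x y by (intro D)
  moreover have "z i = \<one>\<^bsub>A i\<^esub>" if "i \<in> S" for i
  proof -
    have i: "i \<in> I" using that assms by auto
    interpret B: group "A i" using A i by blast
    show ?thesis using D(1)[OF y] that i eq by (auto simp: z_def PiE_iff)
  qed
  moreover have "z j = y j \<otimes>\<^bsub>A j\<^esub> inv\<^bsub>A j\<^esub> x j"
    using assms by (simp add: z_def)
  ultimately have "y j \<otimes>\<^bsub>A j\<^esub> inv\<^bsub>A j\<^esub> x j \<in> section_at A G j S"
    by (intro section_atI[of z]) auto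
  moreover have carr: "x j \<in> carrier (A j)" "y j \<in> carrier (A j)"
    using D(1) x y assms by (auto simp: PiE_iff)
  ultimately have "y j \<in> section_at A G j S #>\<^bsub>A j\<^esub> x j"
    using subgroup.rcos_module_rev[OF section_at_subgroup] assms A by simp
  then show ?thesis
    using A.repr_independence carr section_at_subgroup assms by simp
qed

end

section \<open>From a subgroup to its tuple\<close>

context
  fixes A :: "nat \<Rightarrow> ('a, 'm) monoid_scheme" and n :: nat and G
  assumes A: "\<forall>i\<in>{1..n}. group (A i)" and G: "subgroup G (product_group {1..n} A)"
begin

text \<open>All lifts of one truncated element give the same coset, and \<open>x\<close> is such a
  lift, so the definite description has exactly one solution.\<close>

lemma goursat_theta_restrict:
  assumes i: "Suc i \<le> n" and x: "x \<in> G"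
  shows "goursat_theta A G i (restrict x {1..i}) =
    section_at A G (Suc i) {1..i} #>\<^bsub>A (Suc i)\<^esub> x (Suc i)"
proof -
  have eq: "section_at A G (Suc i) {1..i} #>\<^bsub>A (Suc i)\<^esub> x (Suc i) =
      section_at A G (Suc i) {1..i} #>\<^bsub>A (Suc i)\<^esub> y (Suc i)"
    if "y \<in> G" "restrict y {1..i} = restrict x {1..i}" for y
  proof (rule section_at_coset_eq[OF A G])
    show "x k = y k" if "k \<in> {1..i}" for k
      using fun_cong[OF \<open>restrict y {1..i} = restrict x {1..i}\<close>, of k] that by auto
  qed (use i x that in auto)
  have "(THE C. \<forall>y\<in>G. restrict y {1..i} = restrict x {1..i} \<longrightarrow>
      C = section_at A G (i+1) {1..i} #>\<^bsub>A (i+1)\<^esub> y (i+1)) =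
    section_at A G (Suc i) {1..i} #>\<^bsub>A (Suc i)\<^esub> x (Suc i)"
    using eq x unfolding Suc_eq_plus1[symmetric] by (intro the_equality) blast+
  then show ?thesis
    using x by (simp add: goursat_theta_def initial_proj_def)
qed

text \<open>The product of two lifts is a lift of the product, which gives the homomorphism law.
  Every coset is hit because each element of \<open>section_at A G (Suc i) {}\<close> is a
  coordinate \<open>x (Suc i)\<close> of some \<open>x\<close> in \<open>G\<close>.\<close>

lemma goursat_theta_epi:
  assumes i: "i \<in> {1..n-1}"
  shows "goursat_theta A G i \<in> epi ((product_group {1..i} A)\<lparr>carrier := initial_proj G i\<rparr>)
    ((A (Suc i))\<lparr>carrier := section_at A G (Suc i) {}\<rparr> Mod section_at A G (Suc i) {1..i})"
    (is "_ \<in> epi ?P (?B Mod ?K)")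
proof -
  have Suc: "Suc i \<in> {1..n}" "Suc i \<le> n" and sub: "{1..i} \<subseteq> {1..n}" using i by auto
  note D = subgroup_productD[OF G A]
  note theta = goursat_theta_restrict[OF Suc(2)]
  interpret N: normal ?K ?B
    using section_at_normal[OF A G Suc(1) sub] .
  have mem: "x (Suc i) \<in> carrier ?B" if "x \<in> G" for x
    using that by (auto simp: section_at_def)
  have "goursat_theta A G i ` initial_proj G i = (\<lambda>x. ?K #>\<^bsub>?B\<^esub> x (Suc i)) ` G"
    unfolding initial_proj_def image_image r_coset_consistent by (intro image_cong refl theta)
  also have "\<dots> = carrier (?B Mod ?K)"
    by (auto simp: carrier_FactGroup section_at_def)
  finally have img: "goursat_theta A G i ` initial_proj G i = carrier (?B Mod ?K)" .
  have mult: "goursat_theta A G i (restrict x {1..i} \<otimes>\<^bsub>?P\<^esub> restrict y {1..i}) =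
      goursat_theta A G i (restrict x {1..i}) \<otimes>\<^bsub>?B Mod ?K\<^esub> goursat_theta A G i (restrict y {1..i})"
    if "x \<in> G" "y \<in> G" for x y
  proof -
    let ?z = "\<lambda>i\<in>{1..n}. x i \<otimes>\<^bsub>A i\<^esub> y i"
    have "restrict x {1..i} \<otimes>\<^bsub>?P\<^esub> restrict y {1..i} = restrict ?z {1..i}"
      using i by auto
    then show ?thesis
      using theta[OF D(2)[OF that]] theta[OF that(1)] theta[OF that(2)] Suc(1)
        N.rcos_sum[OF mem[OF that(1)] mem[OF that(2)]]
      by simp
  qed
  show ?thesis
    unfolding epi_def hom_def
    using img mult by (auto simp: initial_proj_def)
qed

text \<open>Truncations of elements of \<open>G\<close> satisfy the coset conditions by the formula
  for \<open>goursat_theta\<close>. Conversely, a coset condition allows the last coordinate of a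
  lift to be corrected within \<open>G\<close> without altering the earlier ones. For
  \<open>i = n\<close> this recovers \<open>G\<close>.\<close>

lemma Lambda_rec_Q:
  assumes Q: "Q A n G = (H, K, \<theta>)" and i: "i \<in> {1..n}"
  shows "Lambda_rec A H K \<theta> i = initial_proj G i"
  using i
proof (induction i)
  case 0
  then show ?case by simp
next
  case (Suc i)
  have H: "H (Suc i) = section_at A G (Suc i) {}"
    using Q Suc.prems by (auto simp: Q_def)
  note D = subgroup_productD[OF G A]
  show ?case
  \<comment> \<open>Level 1 is the true base of the recursion: \<open>\<Lambda>\<^sub>1\<close> is
    given by \<open>H 1\<close> directly, with no coset condition.\<close>
  proof (cases "i = 0")
    case True
    have "u \<in> initial_proj G (Suc 0) \<longleftrightarrow> u \<in> Lambda_rec A H K \<theta> (Suc 0)" for u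
    proof
      assume "u \<in> initial_proj G (Suc 0)"
      then show "u \<in> Lambda_rec A H K \<theta> (Suc 0)"
        unfolding Lambda_rec_1_iff using H True by (auto simp: initial_proj_def section_at_def)
    next
      assume "u \<in> Lambda_rec A H K \<theta> (Suc 0)"
      then have u: "u \<in> extensional {1..Suc 0}" "u (Suc 0) \<in> section_at A G (Suc 0) {}"
        unfolding Lambda_rec_1_iff using H True by auto
      then obtain x where x: "x \<in> G" "u (Suc 0) = x (Suc 0)"
        by (auto simp: section_at_def)
      have "u = restrict x {1..Suc 0}"
        by (rule extensionalityI[OF u(1)]) (use x(2) in auto)
      then show "u \<in> initial_proj G (Suc 0)"
        using x(1) by (auto simp: initial_proj_def)
    qed
    then show ?thesis using True by blast
  next
    case False
    then have i: "i \<ge> 1" "i \<in> {1..n-1}" "Suc i \<in> {1..n}" "Suc i \<le> n" and sub: "{1..i} \<subseteq> {1..n}"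
      using Suc.prems by auto
    have IH: "Lambda_rec A H K \<theta> i = initial_proj G i"
      using Suc.IH i by simp
    have K: "K (Suc i) = section_at A G (Suc i) {1..i}" and \<theta>: "\<theta> i = goursat_theta A G i"
      using Q i by (auto simp: Q_def)
    note theta = goursat_theta_restrict[OF i(4)]
    interpret A: group "A (Suc i)" using A i by blast
    have Ksub: "subgroup (K (Suc i)) (A (Suc i))"
      using section_at_subgroup[OF A G i(3) sub] by (simp add: K)
    show ?thesis
    proof (intro equalityI subsetI)
      fix u assume "u \<in> initial_proj G (Suc i)"
      then obtain x where x: "x \<in> G" "u = restrict x {1..Suc i}"
        by (auto simp: initial_proj_def)
      have r: "restrict u {1..i} = restrict x {1..i}"
        unfolding x by (rule restrict_restrict_initial) simp
      show "u \<in> Lambda_rec A H K \<theta> (Suc i)"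
        unfolding Lambda_rec_Suc_iff[OF i(1)] r IH
        using x theta[OF x(1)] by (auto simp: H K \<theta> section_at_def initial_proj_def)
    next
      fix u assume "u \<in> Lambda_rec A H K \<theta> (Suc i)"
      then have u: "u \<in> extensional {1..Suc i}" "restrict u {1..i} \<in> initial_proj G i"
        "u (Suc i) \<in> H (Suc i)"
        "\<theta> i (restrict u {1..i}) = K (Suc i) #>\<^bsub>A (Suc i)\<^esub> u (Suc i)"
        unfolding Lambda_rec_Suc_iff[OF i(1)] IH by auto
      from u(2) obtain x where x: "x \<in> G" "restrict u {1..i} = restrict x {1..i}"
        by (auto simp: initial_proj_def)
      have carr: "u (Suc i) \<in> carrier (A (Suc i))"
        using u(3) subgroup.subset[OF section_at_subgroup[OF A G i(3), of "{}"]] by (auto simp: H)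
      have "K (Suc i) #>\<^bsub>A (Suc i)\<^esub> x (Suc i) = K (Suc i) #>\<^bsub>A (Suc i)\<^esub> u (Suc i)"
        using u(4) unfolding x(2) \<theta> theta[OF x(1)] K .
      \<comment> \<open>Equality of the cosets makes \<open>u (Suc i)\<close> a multiple of
        \<open>x (Suc i)\<close> by an element of \<open>K (Suc i)\<close>, which lifts to some
        \<open>z\<close> in \<open>G\<close> with trivial first \<open>i\<close>
        coordinates.\<close>
      then have "u (Suc i) \<in> K (Suc i) #>\<^bsub>A (Suc i)\<^esub> x (Suc i)"
        using A.rcos_self[OF carr Ksub] by simp
      then obtain z where z: "z \<in> G" "\<forall>k\<in>{1..i}. z k = \<one>\<^bsub>A k\<^esub>"
        "u (Suc i) = z (Suc i) \<otimes>\<^bsub>A (Suc i)\<^esub> x (Suc i)"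
        by (auto simp: r_coset_def K section_at_def)
      \<comment> \<open>The product \<open>z x\<close> lies in \<open>G\<close>, keeps the first
        \<open>i\<close> coordinates of \<open>x\<close>, which are those of \<open>u\<close>, and
        has the next coordinate of \<open>u\<close>.\<close>
      have "u = restrict (\<lambda>k\<in>{1..n}. z k \<otimes>\<^bsub>A k\<^esub> x k) {1..Suc i}"
      proof
        fix k
        consider "k \<in> {1..i}" | "k = Suc i" | "k \<notin> {1..Suc i}" by force
        then show "u k = restrict (\<lambda>k\<in>{1..n}. z k \<otimes>\<^bsub>A k\<^esub> x k) {1..Suc i} k"
        proof cases
          case 1
          then have k: "k \<in> {1..n}" using sub by blast
          interpret B: group "A k" using A k by blast
          have "u k = x k" using fun_cong[OF x(2), of k] 1 by auto
          then show ?thesis using 1 k z(2) D(1)[OF x(1)] by (auto simp: PiE_iff)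
        next
          case 2
          then show ?thesis using z(3) i by auto
        next
          case 3
          then show ?thesis using u(1) by (auto simp: extensional_def)
        qed
      qed
      then show "u \<in> initial_proj G (Suc i)"
        unfolding initial_proj_def using D(2)[OF z(1) x(1)] by (rule image_eqI)
    qed
  qed
qed

lemma Q_in_goursat_tuples: "Q A n G \<in> goursat_tuples A n"
proof -
  obtain H K \<theta> where Q: "Q A n G = (H, K, \<theta>)" by (cases "Q A n G") auto
  have H: "H = (\<lambda>i\<in>{1..n}. section_at A G i {})"
    and K: "K = (\<lambda>i\<in>{2..n}. section_at A G i {1..i-1})"
    and \<theta>: "\<theta> = (\<lambda>i\<in>{1..n-1}. goursat_theta A G i)"
    using Q by (auto simp: Q_def)
  have "subgroup (H i) (A i)" if "i \<in> {1..n}" for i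
    using that section_at_subgroup[OF A G] by (simp add: H)
  moreover have "K i \<lhd> (A i)\<lparr>carrier := H i\<rparr>" if "i \<in> {2..n}" for i
  proof -
    have "i \<in> {1..n}" "{1..i-1} \<subseteq> {1..n}" using that by auto
    from section_at_normal[OF A G this] show ?thesis using that by (simp add: H K)
  qed
  moreover have "\<theta> i \<in> extensional (Lambda_rec A H K \<theta> i) \<and>
      \<theta> i \<in> epi ((product_group {1..i} A)\<lparr>carrier := Lambda_rec A H K \<theta> i\<rparr>)
                 ((A (i+1))\<lparr>carrier := H (i+1)\<rparr> Mod K (i+1))" if i: "i \<in> {1..n-1}" for i
  proof -
    \<comment> \<open>A tuple requires the domain of \<open>\<theta> i\<close> to be
      \<open>\<Lambda>\<^sub>i\<close>, while \<open>goursat_theta\<close> lives on the projection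
      of \<open>G\<close>; \<open>Lambda_rec_Q\<close> identifies the two.\<close>
    have "H (i+1) = section_at A G (Suc i) {}" "K (i+1) = section_at A G (Suc i) {1..i}"
      "\<theta> i = goursat_theta A G i" "Lambda_rec A H K \<theta> i = initial_proj G i"
      using i Lambda_rec_Q[OF Q, of i] by (auto simp: H K \<theta>)
    then show ?thesis
      using goursat_theta_epi[OF i] goursat_theta_extensional[of A G i] by simp
  qed
  ultimately show ?thesis
    unfolding Q goursat_tuples_def by (auto simp: H K \<theta>)
qed

end

section \<open>From a tuple to a subgroup\<close>

text \<open>Indices of \<open>K\<close> are shifted to \<open>Suc i\<close> to match the recursion.
  Surjectivity is spelled out with cosets in \<open>A (Suc i)\<close>, which are the same sets as
  the cosets in \<open>H (Suc i)\<close>.\<close>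

lemma goursat_tuplesD:
  assumes "(H, K, \<theta>) \<in> goursat_tuples A n" "\<forall>i\<in>{1..n}. group (A i)"
  shows "H \<in> extensional {1..n}" "K \<in> extensional {2..n}" "\<theta> \<in> extensional {1..n-1}"
    and "i \<in> {1..n} \<Longrightarrow> subgroup (H i) (A i)"
    and "i \<in> {1..n-1} \<Longrightarrow> K (Suc i) \<lhd> (A (Suc i))\<lparr>carrier := H (Suc i)\<rparr>"
    and "i \<in> {1..n-1} \<Longrightarrow> subgroup (K (Suc i)) (A (Suc i))"
    and "i \<in> {1..n-1} \<Longrightarrow> \<theta> i \<in> extensional (Lambda_rec A H K \<theta> i)"
    and "i \<in> {1..n-1} \<Longrightarrow> \<theta> i \<in> hom ((product_group {1..i} A)\<lparr>carrier := Lambda_rec A H K \<theta> i\<rparr>)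
                 ((A (Suc i))\<lparr>carrier := H (Suc i)\<rparr> Mod K (Suc i))"
    and "i \<in> {1..n-1} \<Longrightarrow> \<theta> i ` Lambda_rec A H K \<theta> i =
                 (\<lambda>b. K (Suc i) #>\<^bsub>A (Suc i)\<^esub> b) ` H (Suc i)"
proof -
  show sub: "subgroup (H i) (A i)" if "i \<in> {1..n}" for i
    using assms that by (auto simp: goursat_tuples_def)
  show nor: "K (Suc i) \<lhd> (A (Suc i))\<lparr>carrier := H (Suc i)\<rparr>" if "i \<in> {1..n-1}" for i
    using assms that by (auto simp: goursat_tuples_def)
  show "subgroup (K (Suc i)) (A (Suc i))" if "i \<in> {1..n-1}"
  proof -
    have i: "Suc i \<in> {1..n}" using that by auto
    show ?thesis
      using group.incl_subgroup[OF _ sub[OF i]] assms(2) i normal_imp_subgroup[OF nor[OF that]]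
      by auto
  qed
qed (use assms in \<open>auto simp: goursat_tuples_def epi_def carrier_FactGroup\<close>)

context
  fixes A :: "nat \<Rightarrow> ('a, 'm) monoid_scheme" and n :: nat and H K \<theta>
  assumes A: "\<forall>i\<in>{1..n}. group (A i)" and tuple: "(H, K, \<theta>) \<in> goursat_tuples A n"
begin

text \<open>The coset condition at level \<open>i+1\<close> equates two homomorphic images in the
  quotient group, \<open>\<theta> i\<close> of the truncation and the class of the last coordinate,
  so its solutions are closed under the group operations.\<close>

lemma Lambda_rec_subgroup:
  assumes "i \<in> {1..n}"
  shows "subgroup (Lambda_rec A H K \<theta> i) (product_group {1..i} A)"
  using assms
proof (induction i)
  case 0
  then show ?case by simp
next
  case (Suc i)
  note T = goursat_tuplesD[OF tuple A]
  have A': "\<forall>k\<in>{1..i}. group (A k)" "\<forall>k\<in>{1..Suc i}. group (A k)" using A Suc.prems by auto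
  show ?case
  proof (cases "i = 0")
    case True
    then show ?thesis
      using PiE_subgroup_product_group[of "{1::nat}" A H] A' T(4)[of 1] Suc.prems by simp
  next
    case False
    then have i: "i \<ge> 1" "i \<in> {1..n-1}" "i \<in> {1..n}" "Suc i \<in> {1..n}"
      using Suc.prems by auto
    let ?L = "Lambda_rec A H K \<theta> i" and ?B = "(A (Suc i))\<lparr>carrier := H (Suc i)\<rparr>"
    let ?P = "(product_group {1..i} A)\<lparr>carrier := ?L\<rparr>"
    have IH: "subgroup ?L (product_group {1..i} A)"
      using Suc.IH i by simp
    note H = T(4)[OF i(4)]
    interpret A: group "A (Suc i)" using A i by blast
    interpret N: normal "K (Suc i)" ?B using T(5)[OF i(2)] .
    interpret P0: group "product_group {1..i} A" using A'(1) by (intro product_group) blast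
    interpret P: group ?P using subgroup.subgroup_is_group[OF IH P0.group_axioms] .
    \<comment> \<open>\<open>T(8)\<close> gives only a multiplicative map; with groups on both sides
      it also preserves the neutral element and inverses.\<close>
    interpret theta: group_hom ?P "?B Mod K (Suc i)" "\<theta> i"
      using T(8)[OF i(2)] P.group_axioms N.factorgroup_is_group
      by (simp add: group_hom_def group_hom_axioms_def)
    note iff = Lambda_rec_Suc_iff[OF i(1), of _ A H K \<theta>]
    show ?thesis
    proof (rule subgroup_productI)
      show "Lambda_rec A H K \<theta> (Suc i) \<subseteq> (\<Pi>\<^sub>E k\<in>{1..Suc i}. carrier (A k))"
      proof
        fix x assume "x \<in> Lambda_rec A H K \<theta> (Suc i)"
        then have x: "x \<in> extensional {1..Suc i}" "restrict x {1..i} \<in> ?L" "x (Suc i) \<in> H (Suc i)"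
          unfolding iff by auto
        have "x k \<in> carrier (A k)" if "k \<in> {1..Suc i}" for k
          using that subgroup_productD(1)[OF IH A'(1) x(2)] x(3) subgroup.subset[OF H]
          by (cases "k = Suc i") (auto simp: PiE_iff)
        with x(1) show "x \<in> (\<Pi>\<^sub>E k\<in>{1..Suc i}. carrier (A k))" by (auto simp: PiE_iff)
      qed
    next
      have "restrict (\<lambda>k\<in>{1..Suc i}. \<one>\<^bsub>A k\<^esub>) {1..i} = \<one>\<^bsub>?P\<^esub>"
        by auto
      then show "(\<lambda>k\<in>{1..Suc i}. \<one>\<^bsub>A k\<^esub>) \<in> Lambda_rec A H K \<theta> (Suc i)"
        unfolding iff using P.one_closed theta.hom_one subgroup.one_closed[OF H]
          A.coset_mult_one[OF subgroup.subset[OF T(6)[OF i(2)]]]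
        by simp
    next
      fix x y assume "x \<in> Lambda_rec A H K \<theta> (Suc i)" "y \<in> Lambda_rec A H K \<theta> (Suc i)"
      then have x: "restrict x {1..i} \<in> ?L" "x (Suc i) \<in> H (Suc i)"
        "\<theta> i (restrict x {1..i}) = K (Suc i) #>\<^bsub>?B\<^esub> x (Suc i)"
        and y: "restrict y {1..i} \<in> ?L" "y (Suc i) \<in> H (Suc i)"
        "\<theta> i (restrict y {1..i}) = K (Suc i) #>\<^bsub>?B\<^esub> y (Suc i)"
        unfolding iff by auto
      have "restrict (\<lambda>k\<in>{1..Suc i}. x k \<otimes>\<^bsub>A k\<^esub> y k) {1..i} = restrict x {1..i} \<otimes>\<^bsub>?P\<^esub> restrict y {1..i}"
        by auto
      then show "(\<lambda>k\<in>{1..Suc i}. x k \<otimes>\<^bsub>A k\<^esub> y k) \<in> Lambda_rec A H K \<theta> (Suc i)"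
        unfolding iff
        using P.m_closed[of "restrict x {1..i}" "restrict y {1..i}"] x y
          theta.hom_mult[of "restrict x {1..i}" "restrict y {1..i}"]
          N.rcos_sum[of "x (Suc i)" "y (Suc i)"] subgroup.m_closed[OF H x(2) y(2)]
        by simp
    next
      fix x assume "x \<in> Lambda_rec A H K \<theta> (Suc i)"
      then have x: "restrict x {1..i} \<in> ?L" "x (Suc i) \<in> H (Suc i)"
        "\<theta> i (restrict x {1..i}) = K (Suc i) #>\<^bsub>?B\<^esub> x (Suc i)"
        unfolding iff by auto
      \<comment> \<open>The inverses in \<open>?P\<close>, in the full product and in coordinates
        agree, so truncation commutes with inversion.\<close>
      have "inv\<^bsub>?P\<^esub> restrict x {1..i} = inv\<^bsub>product_group {1..i} A\<^esub> restrict x {1..i}"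
        using P0.m_inv_consistent[OF IH x(1)] .
      also have "\<dots> = restrict (\<lambda>k\<in>{1..Suc i}. inv\<^bsub>A k\<^esub> x k) {1..i}"
        using inv_product_group[OF subgroup_productD(1)[OF IH A'(1) x(1)]] A' by auto
      finally have r: "restrict (\<lambda>k\<in>{1..Suc i}. inv\<^bsub>A k\<^esub> x k) {1..i} = inv\<^bsub>?P\<^esub> restrict x {1..i}"
        by simp
      have "\<theta> i (inv\<^bsub>?P\<^esub> restrict x {1..i}) = inv\<^bsub>?B Mod K (Suc i)\<^esub> (K (Suc i) #>\<^bsub>?B\<^esub> x (Suc i))"
        using theta.hom_inv[of "restrict x {1..i}"] x by simp
      also have "\<dots> = K (Suc i) #>\<^bsub>?B\<^esub> inv\<^bsub>?B\<^esub> x (Suc i)"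
        using N.inv_FactGroup[of "K (Suc i) #>\<^bsub>?B\<^esub> x (Suc i)"] N.rcos_inv[of "x (Suc i)"] x(2)
        by (simp add: carrier_FactGroup)
      also have "inv\<^bsub>?B\<^esub> x (Suc i) = inv\<^bsub>A (Suc i)\<^esub> x (Suc i)"
        using A.m_inv_consistent[OF H x(2)] .
      finally have "\<theta> i (inv\<^bsub>?P\<^esub> restrict x {1..i}) = K (Suc i) #>\<^bsub>A (Suc i)\<^esub> inv\<^bsub>A (Suc i)\<^esub> x (Suc i)"
        by (simp only: r_coset_consistent)
      moreover have "inv\<^bsub>?P\<^esub> restrict x {1..i} \<in> ?L"
        using P.inv_closed[of "restrict x {1..i}"] x by simp
      moreover have "(\<lambda>k\<in>{1..Suc i}. inv\<^bsub>A k\<^esub> x k) (Suc i) = inv\<^bsub>A (Suc i)\<^esub> x (Suc i)"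
        by simp
      ultimately show "(\<lambda>k\<in>{1..Suc i}. inv\<^bsub>A k\<^esub> x k) \<in> Lambda_rec A H K \<theta> (Suc i)"
        unfolding iff r using subgroup.m_inv_closed[OF H x(2)] restrict_extensional by metis
    qed (use A' in blast)
  qed
qed

text \<open>For \<open>a\<close> in \<open>\<Lambda>\<^sub>i\<close> the value
  \<open>\<theta> i a\<close> is the coset of some \<open>b\<close> in \<open>H (Suc i)\<close>, and
  appending \<open>b\<close> to \<open>a\<close> gives an element of the next level.\<close>

lemma initial_proj_Lambda_rec_Suc:
  assumes i: "i \<in> {1..n-1}"
  shows "initial_proj (Lambda_rec A H K \<theta> (Suc i)) i = Lambda_rec A H K \<theta> i"
proof (intro equalityI subsetI)
  have i1: "i \<ge> 1" using i by simp
  note iff = Lambda_rec_Suc_iff[OF i1, of _ A H K \<theta>]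
  note T = goursat_tuplesD[OF tuple A]
  show "a \<in> Lambda_rec A H K \<theta> i" if "a \<in> initial_proj (Lambda_rec A H K \<theta> (Suc i)) i" for a
    using that by (auto simp only: initial_proj_def iff)
  fix a assume a: "a \<in> Lambda_rec A H K \<theta> i"
  then obtain b where b: "b \<in> H (Suc i)" "\<theta> i a = K (Suc i) #>\<^bsub>A (Suc i)\<^esub> b"
    using T(9)[OF i] by blast
  have ext: "a \<in> extensional {1..i}"
    using a i1 Lambda_rec_extensional[of A H K \<theta> "i - 1"] by auto
  then have r: "restrict (a(Suc i := b)) {1..i} = a"
    by (auto simp: extensional_def fun_eq_iff)
  have "a(Suc i := b) \<in> Lambda_rec A H K \<theta> (Suc i)"
    unfolding iff r using a b ext by (auto simp: extensional_def)
  then show "a \<in> initial_proj (Lambda_rec A H K \<theta> (Suc i)) i"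
    unfolding initial_proj_def using r by (metis imageI)
qed

text \<open>One-step truncations are composed, from level \<open>m\<close> down to level
  \<open>i\<close>.\<close>

lemma initial_proj_Lambda_rec:
  assumes "1 \<le> i" "i \<le> m" "m \<le> n"
  shows "initial_proj (Lambda_rec A H K \<theta> m) i = Lambda_rec A H K \<theta> i"
  using assms(2,3)
proof (induction m rule: dec_induct)
  case base
  show ?case
    using Lambda_rec_extensional[of A H K \<theta> "i - 1"] assms(1) by (intro initial_proj_self) simp
next
  case (step m)
  then show ?case
    using initial_proj_initial_proj[of i m "Lambda_rec A H K \<theta> (Suc m)"] initial_proj_Lambda_rec_Suc[of m] assms(1)
    by simp
qed

text \<open>Here surjectivity of the homomorphisms enters: the coset of \<open>b\<close> in
  \<open>H (Suc k)\<close> is the value of \<open>\<theta> k\<close> at some \<open>a\<close>, and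
  \<open>a\<close> extended by \<open>b\<close> is the required lift of \<open>b\<close>.\<close>

lemma section_at_Lambda_rec_empty:
  assumes i: "i \<in> {1..n}"
  shows "section_at A (Lambda_rec A H K \<theta> i) i {} = H i"
proof -
  note T = goursat_tuplesD[OF tuple A]
  obtain k where k: "i = Suc k" using i by (cases i) auto
  show ?thesis
  proof (cases "k = 0")
    case True
    have "b \<in> section_at A (Lambda_rec A H K \<theta> (Suc 0)) (Suc 0) {}" if "b \<in> H (Suc 0)" for b
      using that by (intro section_atI[of "\<lambda>i\<in>{1..Suc 0}. b"]) (auto simp only: Lambda_rec_1_iff, auto)
    moreover have "section_at A (Lambda_rec A H K \<theta> (Suc 0)) (Suc 0) {} \<subseteq> H (Suc 0)"
      by (auto simp only: section_at_def Lambda_rec_1_iff)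
    ultimately show ?thesis
      using True k by auto
  next
    case False
    then have k1: "k \<ge> 1" "k \<in> {1..n-1}" using i k by auto
    note iff = Lambda_rec_Suc_iff[OF k1(1), of _ A H K \<theta>]
    have "b \<in> section_at A (Lambda_rec A H K \<theta> (Suc k)) (Suc k) {}" if b: "b \<in> H (Suc k)" for b
    proof -
      obtain a where a: "a \<in> Lambda_rec A H K \<theta> k" "\<theta> k a = K (Suc k) #>\<^bsub>A (Suc k)\<^esub> b"
        using T(9)[OF k1(2)] b by (metis (no_types, lifting) imageE imageI)
      have ext: "a \<in> extensional {1..k}"
        using a k1 Lambda_rec_extensional[of A H K \<theta> "k - 1"] by auto
      then have r: "restrict (a(Suc k := b)) {1..k} = a"
        by (auto simp: extensional_def fun_eq_iff)
      have "a(Suc k := b) \<in> Lambda_rec A H K \<theta> (Suc k)"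
        unfolding iff r using a b ext by (auto simp: extensional_def)
      then show ?thesis
        by (intro section_atI[of "a(Suc k := b)"]) auto
    qed
    then show ?thesis
      unfolding k by (auto simp: section_at_def iff)
  qed
qed

text \<open>A homomorphism sends the neutral element \<open>?e\<close> to the trivial coset
  \<open>K (Suc i)\<close>. Hence an element \<open>b\<close> of \<open>H (Suc i)\<close> can be
  appended to \<open>?e\<close> exactly when its coset is trivial, that is, when \<open>b\<close>
  lies in \<open>K (Suc i)\<close>.\<close>

lemma section_at_Lambda_rec_Suc:
  assumes i: "i \<in> {1..n-1}"
  shows "section_at A (Lambda_rec A H K \<theta> (Suc i)) (Suc i) {1..i} = K (Suc i)"
proof -
  note T = goursat_tuplesD[OF tuple A]
  have i1: "i \<ge> 1" "i \<in> {1..n}" "Suc i \<in> {1..n}" using i by auto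
  note iff = Lambda_rec_Suc_iff[OF i1(1), of _ A H K \<theta>]
  let ?L = "Lambda_rec A H K \<theta> i" and ?B = "(A (Suc i))\<lparr>carrier := H (Suc i)\<rparr>"
  let ?P = "(product_group {1..i} A)\<lparr>carrier := ?L\<rparr>"
  let ?e = "\<lambda>k\<in>{1..i}. \<one>\<^bsub>A k\<^esub>"
  have A': "\<forall>k\<in>{1..i}. group (A k)" using A i by auto
  note L = Lambda_rec_subgroup[OF i1(2)]
  interpret A: group "A (Suc i)" using A i1 by blast
  interpret N: normal "K (Suc i)" ?B using T(5)[OF i] .
  interpret P: group ?P using subgroup.subgroup_is_group[OF L product_group] A' by blast
  interpret theta: group_hom ?P "?B Mod K (Suc i)" "\<theta> i"
    using T(8)[OF i] P.group_axioms N.factorgroup_is_group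
    by (simp add: group_hom_def group_hom_axioms_def)
  have one: "?e \<in> ?L" "\<theta> i ?e = K (Suc i)"
    using P.one_closed theta.hom_one by simp_all
  have KH: "K (Suc i) \<subseteq> H (Suc i)" using N.subset by simp
  have HA: "H (Suc i) \<subseteq> carrier (A (Suc i))" using subgroup.subset[OF T(4)[OF i1(3)]] .
  show ?thesis
  proof (intro equalityI subsetI)
    fix b assume "b \<in> section_at A (Lambda_rec A H K \<theta> (Suc i)) (Suc i) {1..i}"
    then obtain x where x: "x \<in> Lambda_rec A H K \<theta> (Suc i)" "\<forall>k\<in>{1..i}. x k = \<one>\<^bsub>A k\<^esub>" "b = x (Suc i)"
      by (auto simp: section_at_def)
    have "restrict x {1..i} = ?e" using x(2) by auto
    then have "K (Suc i) #>\<^bsub>A (Suc i)\<^esub> b = K (Suc i)" "b \<in> H (Suc i)"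
      using x(1,3) one(2) unfolding iff by auto
    then show "b \<in> K (Suc i)"
      using A.coset_join1[OF _ _ T(6)[OF i]] HA by blast
  next
    fix b assume b: "b \<in> K (Suc i)"
    have r: "restrict (?e(Suc i := b)) {1..i} = ?e"
      by (auto simp: fun_eq_iff)
    have "K (Suc i) #>\<^bsub>A (Suc i)\<^esub> b = K (Suc i)"
      using A.coset_join2[OF _ T(6)[OF i] b] b KH HA by blast
    then have "?e(Suc i := b) \<in> Lambda_rec A H K \<theta> (Suc i)"
      unfolding iff r using one b KH by (auto simp: extensional_def)
    then show "b \<in> section_at A (Lambda_rec A H K \<theta> (Suc i)) (Suc i) {1..i}"
      unfolding section_at_def by (auto intro!: exI[of _ "?e(Suc i := b)"])
  qed
qed

text \<open>All entries are computed in truncations of \<open>\<Lambda>\<^sub>n\<close>, which are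
  the earlier \<open>\<Lambda>\<^sub>i\<close>. The sections are known there, and the membership
  condition of level \<open>i+1\<close> is the formula that determines
  \<open>goursat_theta\<close>.\<close>

lemma Q_Lambda_rec:
  assumes n: "n \<ge> 1"
  shows "Q A n (Lambda_rec A H K \<theta> n) = (H, K, \<theta>)"
proof -
  note T = goursat_tuplesD[OF tuple A]
  let ?G = "Lambda_rec A H K \<theta> n"
  have G: "subgroup ?G (product_group {1..n} A)"
    using Lambda_rec_subgroup n by simp
  note proj = initial_proj_Lambda_rec[of _ n, OF _ _ order_refl]
  have H: "section_at A ?G i {} = H i" if "i \<in> {1..n}" for i
    using section_at_initial_proj[of i i "{}" A ?G] section_at_Lambda_rec_empty[OF that] proj[of i] that
    by simp
  have K: "section_at A ?G (Suc i) {1..i} = K (Suc i)" if "i \<in> {1..n-1}" for i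
  proof -
    have "{1..i} \<subseteq> {1..Suc i}" by auto
    then show ?thesis
      using section_at_initial_proj[of "Suc i" "Suc i" "{1..i}" A ?G] section_at_Lambda_rec_Suc[OF that]
        proj[of "Suc i"] that by force
  qed
  have \<theta>: "goursat_theta A ?G i = \<theta> i" if i: "i \<in> {1..n-1}" for i
  proof (rule extensionalityI)
    have i': "1 \<le> i" "i \<le> n" using i by auto
    show "goursat_theta A ?G i \<in> extensional (Lambda_rec A H K \<theta> i)"
      using goursat_theta_extensional[of A ?G i] unfolding proj[OF i'] .
    show "\<theta> i \<in> extensional (Lambda_rec A H K \<theta> i)" using T(7)[OF i] .
    fix a assume "a \<in> Lambda_rec A H K \<theta> i"
    then have "a \<in> initial_proj ?G i" unfolding proj[OF i'] .
    then obtain x where x: "x \<in> ?G" "a = restrict x {1..i}" by (auto simp: initial_proj_def)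
    \<comment> \<open>Truncating to \<open>i+1\<close> coordinates instead of \<open>i\<close>
      exposes the coset condition that fixes \<open>\<theta> i a\<close>.\<close>
    have "restrict x {1..Suc i} \<in> initial_proj ?G (Suc i)"
      using x(1) by (auto simp: initial_proj_def)
    then have "restrict x {1..Suc i} \<in> Lambda_rec A H K \<theta> (Suc i)"
      using proj[of "Suc i"] i by fastforce
    moreover have "restrict (restrict x {1..Suc i}) {1..i} = a"
      unfolding x(2) by (rule restrict_restrict_initial) simp
    ultimately have "\<theta> i a = K (Suc i) #>\<^bsub>A (Suc i)\<^esub> x (Suc i)"
      using Lambda_rec_Suc_iff[of i "restrict x {1..Suc i}" A H K \<theta>] i by simp
    then show "goursat_theta A ?G i a = \<theta> i a"
      using goursat_theta_restrict[OF A G _ x(1), of i] K[OF i] i x(2) by force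
  qed
  have "(\<lambda>i\<in>{1..n}. section_at A ?G i {}) = H"
    by (rule extensionalityI[OF restrict_extensional T(1)]) (simp add: H)
  moreover have "(\<lambda>i\<in>{2..n}. section_at A ?G i {1..i-1}) = K"
  proof (rule extensionalityI)
    show "(\<lambda>i\<in>{2..n}. section_at A ?G i {1..i-1}) i = K i" if "i \<in> {2..n}" for i
    proof -
      have "i - 1 \<in> {1..n-1}" "Suc (i - 1) = i" using that by auto
      then show ?thesis using K[of "i - 1"] that by simp
    qed
  qed (use T(2) in auto)
  moreover have "(\<lambda>i\<in>{1..n-1}. goursat_theta A ?G i) = \<theta>"
    by (rule extensionalityI[OF restrict_extensional T(3)]) (simp add: \<theta>)
  ultimately show ?thesis by (simp add: Q_def)
qed

end

section \<open>The bijective correspondence\<close>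

text \<open>The second conjunct is there because \<open>goursat_theta\<close> is defined by a
  definite description: it confirms that the homomorphisms of the tuple live on the projections of
  \<open>G\<close> and take the intended value for every choice of lift.\<close>

theorem theorem3p2:
  fixes A :: "nat \<Rightarrow> ('a, 'm) monoid_scheme" and n :: nat
  assumes "n \<ge> 2"
    and "\<And>i. i \<in> {1..n} \<Longrightarrow> group (A i)"
  shows "bij_betw (Q A n) {G. subgroup G (product_group {1..n} A)} (goursat_tuples A n) \<and>
    (\<forall>G H K \<theta>. subgroup G (product_group {1..n} A) \<longrightarrow> Q A n G = (H, K, \<theta>) \<longrightarrow>
       (\<forall>i\<in>{1..n-1}.
          Lambda_rec A H K \<theta> i = initial_proj G i \<and>
          (\<forall>x\<in>G. \<theta> i (restrict x {1..i}) = K (i+1) #>\<^bsub>A (i+1)\<^esub> x (i+1))))"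
proof (intro conjI allI impI ballI)
  have A: "\<forall>i\<in>{1..n}. group (A i)" using assms(2) by blast
  show "bij_betw (Q A n) {G. subgroup G (product_group {1..n} A)} (goursat_tuples A n)"
  proof (rule bij_betw_byWitness[where f' = "\<lambda>(H, K, \<theta>). Lambda_rec A H K \<theta> n"])
    show "\<forall>G\<in>{G. subgroup G (product_group {1..n} A)}.
        (case Q A n G of (H, K, \<theta>) \<Rightarrow> Lambda_rec A H K \<theta> n) = G"
    proof
      fix G assume "G \<in> {G. subgroup G (product_group {1..n} A)}"
      then have G: "subgroup G (product_group {1..n} A)" by simp
      have "G \<subseteq> extensional {1..n}"
        using subgroup.subset[OF G] by (auto simp: PiE_iff)
      then show "(case Q A n G of (H, K, \<theta>) \<Rightarrow> Lambda_rec A H K \<theta> n) = G"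
        using Lambda_rec_Q[OF A G, of _ _ _ n] initial_proj_self[of G n] assms(1)
        by (simp split: prod.split)
    qed
    show "\<forall>q\<in>goursat_tuples A n. Q A n (case q of (H, K, \<theta>) \<Rightarrow> Lambda_rec A H K \<theta> n) = q"
      using Q_Lambda_rec[OF A] assms(1) by auto
    show "Q A n ` {G. subgroup G (product_group {1..n} A)} \<subseteq> goursat_tuples A n"
      using Q_in_goursat_tuples[OF A] by auto
    show "(\<lambda>(H, K, \<theta>). Lambda_rec A H K \<theta> n) ` goursat_tuples A n
        \<subseteq> {G. subgroup G (product_group {1..n} A)}"
      using Lambda_rec_subgroup[OF A, where i = n] assms(1) by auto
  qed
next
  have A: "\<forall>i\<in>{1..n}. group (A i)" using assms(2) by blast
  fix G H K \<theta> i
  assume G: "subgroup G (product_group {1..n} A)" and Q: "Q A n G = (H, K, \<theta>)" and i: "i \<in> {1..n-1}"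
  show "Lambda_rec A H K \<theta> i = initial_proj G i"
    using i by (intro Lambda_rec_Q[OF A G Q]) auto
  have "Suc i \<le> n" "Suc i \<in> {2..n}" using i by auto
  moreover from this have "K (Suc i) = section_at A G (Suc i) {1..i}" "\<theta> i = goursat_theta A G i"
    using Q i by (auto simp: Q_def)
  ultimately show "\<theta> i (restrict x {1..i}) = K (i+1) #>\<^bsub>A (i+1)\<^esub> x (i+1)" if "x \<in> G" for x
    using goursat_theta_restrict[OF A G _ that, of i] by simp
qed

end
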